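(* Let $\mathcal{A}$ be the Hopf $*$-algebra of a compact quantum group with unitary antipode $R$. If $\phi$ is a generating functional of a Lévy process on $\mathcal{A}$ with Schürmann triple $((\pi,D),\eta,\phi)$ on $\mathcal{A}$, then $\phi\circ R$ is a generating functional of a Lévy process on $\mathcal{A}$ with Schürmann triple $((\pi^{\mathrm{op}},D^{\mathrm{op}}),\eta^{\mathrm{op}},\phi\circ R)$ on $\mathcal{A}$, where $\pi^{\mathrm{op}}$ is the opposite representation on the opposite space $D^{\mathrm{op}}$ and $\eta^{\mathrm{op}}:\mathcal{A}\to D^{\mathrm{op}}$ is defined by $\eta^{\mathrm{op}}(a)=\overline{\eta(R(a^* ))}$.
   Context: $\mathcal{A}$ is the dense Hopf $*$-algebra spanned by coefficients of finite-dimensional unitary corepresentations of a compact quantum group $(\mathsf{A},\Delta)$, with counit $\varepsilon$, antipode $S$, Haar state $h$. For $\lambda\in\mathcal{A}'$, $a\in\mathcal{A}$: $\lambda\star a=(\mathrm{id}\otimes\lambda)\Delta(a)$, $a\star\lambda=(\lambda\otimes\mathrm{id})\Delta(a)$, and for $\lambda,\mu\in\mathcal{A}'$, $\lambda\star\mu=(\lambda\otimes\mu)\circ\Delta$. Woronowicz characters: $(f_z)_{z\in\mathbb{C}}$ is the unique family of multiplicative linear functionals on $\mathcal{A}$ with $f_z(1)=1$, $z\mapsto f_z(a)$ entire, $f_0=\varepsilon$, $f_{z_1}\star f_{z_2}=f_{z_1+z_2}$, $f_z(S(a))=f_{-z}(a)$, $f_{\bar z}(a^* )=\overline{f_{-z}(a)}$,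 $S^2(a)=f_{-1}\star a\star f_1$, $h(ab)=h(b(f_1\star a\star f_1))$. The unitary antipode is $R(a)=S(f_{1/2}\star a\star f_{-1/2})$; it is a linear antimultiplicative involution on $\mathcal{A}$ commuting with $*$. A generating functional of a Lévy process on $\mathcal{A}$ is a hermitian linear functional $\phi:\mathcal{A}\to\mathbb{C}$ with $\phi(1)=0$ and $\phi(a^*a)\ge0$ for $a\in\ker\varepsilon$. For a pre-Hilbert space $D$ (inner products linear in the right entry), $\mathcal{L}^{\#}(D)$ is the set of linear operators $D\to D$ admitting an adjoint $D\to D$. A Schürmann triple $((\pi,D),\eta,\phi)$ on $\mathcal{A}$ consists of a unital $*$-representation $\pi:\mathcal{A}\to\mathcal{L}^{\#}(D)$ on a pre-Hilbert space $D$, a linear map $\eta:\mathcal{A}\to D$ with $\eta(ab)=\pi(a)\eta(b)+\eta(a)\varepsilon(b)$ for all $a,b\in\mathcal{A}$, and a hermitian linear functional $\phi:\mathcal{A}\to\mathbb{C}$ with $\phi(ab)=\langle\eta(a^* ),\eta(b)\rangle$ for all $a,b\in\ker\varepsilon$. The opposite space $D^{\mathrm{op}}=\{\overline{v}:v\in D\}$ has addition $\overline v+\overline w=\overline{v+w}$, scalar multiplication $\lambda\cdot\overline v=\overline{\overline\lambda v}$ and inner product $\langle\overline v,\overline w\rangle_{\mathrm{op}}=\langle w,v\rangle$. The opposite representation is $\pi^{\mathrm{op}}(a)\overline v=\overline{\pi(R(a^* ))v}$. *)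

theory Defs
  imports "HOL-Analysis.Analysis"
begin

section \<open>Complex vector spaces, pre-Hilbert spaces and C*-algebras\<close>

class scaleC =
  fixes scaleC :: "complex \<Rightarrow> 'a \<Rightarrow> 'a"  (infixr \<open>*\<^sub>C\<close> 75)

class complex_vector = real_vector + scaleC +
  assumes scaleC_add_right: "c *\<^sub>C (x + y) = c *\<^sub>C x + c *\<^sub>C y"
    and scaleC_add_left: "(c + d) *\<^sub>C x = c *\<^sub>C x + d *\<^sub>C x"
    and scaleC_scaleC: "c *\<^sub>C d *\<^sub>C x = (c * d) *\<^sub>C x"
    and scaleR_scaleC: "r *\<^sub>R x = complex_of_real r *\<^sub>C x"

lemma scaleC_one: "1 *\<^sub>C (x :: 'a::complex_vector) = x"
  using scaleR_scaleC[of 1 x] by simp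

global_interpretation complex_vector?: vector_space "scaleC :: complex \<Rightarrow> 'a \<Rightarrow> 'a::complex_vector"
  defines cspan_raw_def: cspan = complex_vector.span
    and csubspace_raw_def: csubspace = complex_vector.subspace
  by unfold_locales (simp_all add: scaleC_add_right scaleC_add_left scaleC_scaleC scaleC_one)

abbreviation clinear :: "('a::complex_vector \<Rightarrow> 'b::complex_vector) \<Rightarrow> bool" where
  "clinear \<equiv> Vector_Spaces.linear scaleC scaleC"

instantiation complex :: complex_vector
begin
definition scaleC_complex :: "complex \<Rightarrow> complex \<Rightarrow> complex" where
  "scaleC_complex c z = c * z"
instance
  by standard (simp_all add: scaleC_complex_def algebra_simps scaleR_conv_of_real)
end

text \<open>A complex inner product space, not necessarily complete; the inner product is linear in
  its right argument.\<close>

class pre_hilbert = complex_vector +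
  fixes cinner :: "'a \<Rightarrow> 'a \<Rightarrow> complex"
  assumes cinner_commute: "cinner v w = cnj (cinner w v)"
    and cinner_add_right: "cinner v (w + w') = cinner v w + cinner v w'"
    and cinner_scaleC_right: "cinner v (c *\<^sub>C w) = c * cinner v w"
    and cinner_nonneg: "cinner v v \<in> \<real>\<^sub>\<ge>\<^sub>0"
    and cinner_eq_zero_iff: "cinner v v = 0 \<longleftrightarrow> v = 0"

text \<open>Unital C*-algebras with \<open>1 \<noteq> 0\<close>.\<close>

class cstar_algebra = complex_vector + banach + real_normed_algebra_1 +
  fixes star :: "'a \<Rightarrow> 'a"
  assumes scaleC_mult_left: "(c *\<^sub>C x) * y = c *\<^sub>C (x * y)"
    and scaleC_mult_right: "x * (c *\<^sub>C y) = c *\<^sub>C (x * y)"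
    and norm_scaleC: "norm (c *\<^sub>C x) = cmod c * norm x"
    and star_star: "star (star x) = x"
    and star_add: "star (x + y) = star x + star y"
    and star_scaleC: "star (c *\<^sub>C x) = cnj c *\<^sub>C star x"
    and star_mult: "star (x * y) = star y * star x"
    and cstar_identity: "norm (star x * x) = (norm x)\<^sup>2"

definition unital_star_hom :: "('a::cstar_algebra \<Rightarrow> 'b::cstar_algebra) \<Rightarrow> bool" where
  "unital_star_hom F \<longleftrightarrow> clinear F \<and> F 1 = 1 \<and> (\<forall>x y. F (x * y) = F x * F y) \<and>
     (\<forall>x. F (star x) = star (F x))"

definition linear_on_subspace ::
    "'a::complex_vector set \<Rightarrow> ('a \<Rightarrow> 'v::complex_vector) \<Rightarrow> bool" where
  "linear_on_subspace V F \<longleftrightarrow> (\<forall>x\<in>V. \<forall>y\<in>V. F (x + y) = F x + F y) \<and>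
     (\<forall>c. \<forall>x\<in>V. F (c *\<^sub>C x) = c *\<^sub>C F x)"


section \<open>The minimal tensor product of C*-algebras\<close>

definition cstar_norm_on :: "'a::cstar_algebra set \<Rightarrow> ('a \<Rightarrow> real) \<Rightarrow> bool" where
  "cstar_norm_on V \<gamma> \<longleftrightarrow>
     (\<forall>x\<in>V. 0 \<le> \<gamma> x \<and> (\<gamma> x = 0 \<longleftrightarrow> x = 0) \<and> \<gamma> (star x * x) = (\<gamma> x)\<^sup>2) \<and>
     (\<forall>c. \<forall>x\<in>V. \<gamma> (c *\<^sub>C x) = cmod c * \<gamma> x) \<and>
     (\<forall>x\<in>V. \<forall>y\<in>V. \<gamma> (x + y) \<le> \<gamma> x + \<gamma> y \<and> \<gamma> (x * y) \<le> \<gamma> x * \<gamma> y)"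

text \<open>The C*-algebra \<open>'c\<close>, with elementary tensors \<open>a \<otimes> b = tens a b\<close>, is the minimal tensor
  product of \<open>'a\<close> and \<open>'b\<close>: by \<open>tens_injective\<close> the span of the elementary tensors is the
  algebraic tensor product, by \<open>tens_dense\<close> and completeness \<open>'c\<close> is its completion, and by
  \<open>tens_minimal\<close> the norm is the smallest C*-norm. This determines \<open>'c\<close> up to a unique
  isomorphism compatible with the elementary tensors.\<close>

locale minimal_tensor_product =
  fixes tens :: "'a::cstar_algebra \<Rightarrow> 'b::cstar_algebra \<Rightarrow> 'c::cstar_algebra"
  assumes tens_linear_left: "clinear (\<lambda>a. tens a b)"
    and tens_linear_right: "clinear (\<lambda>b. tens a b)"
    and tens_mult: "tens a b * tens a' b' = tens (a * a') (b * b')"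
    and tens_one: "tens 1 1 = 1"
    and tens_star: "star (tens a b) = tens (star a) (star b)"
    and tens_injective:
      "\<And>(n::nat) x y. (\<And>c. (\<Sum>i<n. c i *\<^sub>C x i) = 0 \<Longrightarrow> (\<forall>i<n. c i = 0)) \<Longrightarrow>
         (\<Sum>i<n. tens (x i) (y i)) = 0 \<Longrightarrow> (\<forall>i<n. y i = 0)"
    and tens_dense: "closure (cspan {tens a b | a b. True}) = UNIV"
    and tens_minimal:
      "cstar_norm_on (cspan {tens a b | a b. True}) \<gamma> \<Longrightarrow> z \<in> cspan {tens a b | a b. True} \<Longrightarrow>
         norm z \<le> \<gamma> z"


section \<open>Compact quantum groups\<close>

text \<open>\<open>'a\<close> is the C*-algebra \<open>A\<close>, \<open>'b\<close> is \<open>A \<otimes> A\<close>, and \<open>'c\<close> is \<open>A \<otimes> A \<otimes> A\<close>, presented both as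
  \<open>(A \<otimes> A) \<otimes> A\<close> (via \<open>tens_l\<close>) and as \<open>A \<otimes> (A \<otimes> A)\<close> (via \<open>tens_r\<close>). In \<open>coassociative\<close>,
  the *-homomorphisms \<open>F\<close> and \<open>G\<close> are \<open>\<Delta> \<otimes> id\<close> and \<open>id \<otimes> \<Delta>\<close>, which are uniquely determined by
  their values on elementary tensors.\<close>

locale compact_quantum_group =
  tens: minimal_tensor_product tens +
  tens_l: minimal_tensor_product tens_l +
  tens_r: minimal_tensor_product tens_r
  for tens :: "'a::cstar_algebra \<Rightarrow> 'a \<Rightarrow> 'b::cstar_algebra"
    and tens_l :: "'b \<Rightarrow> 'a \<Rightarrow> 'c::cstar_algebra"
    and tens_r :: "'a \<Rightarrow> 'b \<Rightarrow> 'c" +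
  fixes \<Delta> :: "'a \<Rightarrow> 'b"
  assumes tens_assoc: "tens_l (tens x y) z = tens_r x (tens y z)"
    and comult_hom: "unital_star_hom \<Delta>"
    and coassociative:
      "\<exists>F G. unital_star_hom F \<and> (\<forall>x y. F (tens x y) = tens_l (\<Delta> x) y) \<and>
             unital_star_hom G \<and> (\<forall>x y. G (tens x y) = tens_r x (\<Delta> y)) \<and>
             (\<forall>a. F (\<Delta> a) = G (\<Delta> a))"
    and cancellation_left: "closure (cspan {\<Delta> a * tens b 1 | a b. True}) = UNIV"
    and cancellation_right: "closure (cspan {\<Delta> a * tens 1 b | a b. True}) = UNIV"

text \<open>\<open>u\<close> is an \<open>n \<times> n\<close> matrix over \<open>A\<close>, indexed by \<open>{0..<n}\<close>, i.e. an element of \<open>M\<^sub>n \<otimes> A\<close>.\<close>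

definition unitary_corep ::
    "('a::cstar_algebra \<Rightarrow> 'a \<Rightarrow> 'b::cstar_algebra) \<Rightarrow> ('a \<Rightarrow> 'b) \<Rightarrow> nat \<Rightarrow> (nat \<Rightarrow> nat \<Rightarrow> 'a) \<Rightarrow> bool"
  where
  "unitary_corep tens \<Delta> n u \<longleftrightarrow>
     (\<forall>i<n. \<forall>j<n.
        \<Delta> (u i j) = (\<Sum>k<n. tens (u i k) (u k j)) \<and>
        (\<Sum>k<n. star (u k i) * u k j) = (if i = j then 1 else 0) \<and>
        (\<Sum>k<n. u i k * star (u j k)) = (if i = j then 1 else 0))"

definition coefficient_algebra ::
    "('a::cstar_algebra \<Rightarrow> 'a \<Rightarrow> 'b::cstar_algebra) \<Rightarrow> ('a \<Rightarrow> 'b) \<Rightarrow> 'a set" where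
  "coefficient_algebra tens \<Delta> = cspan {u i j | n u i j. unitary_corep tens \<Delta> n u \<and> i < n \<and> j < n}"

text \<open>For a bilinear map \<open>\<beta>\<close> on a subspace \<open>\<A>\<close>, \<open>tensor_lift tens \<A> \<beta>\<close> is the induced linear map
  \<open>a \<otimes> b \<mapsto> \<beta> a b\<close> on the algebraic tensor product of \<open>\<A>\<close> with itself (the span of the
  \<open>tens a b\<close>, \<open>a, b \<in> \<A>\<close>). The value does not depend on the representation of \<open>z\<close>, because the
  algebraic tensor product embeds into the minimal one.\<close>

definition tensor_lift ::
    "('a \<Rightarrow> 'a \<Rightarrow> 'b::cstar_algebra) \<Rightarrow> 'a::cstar_algebra set \<Rightarrow>
     ('a \<Rightarrow> 'a \<Rightarrow> 'v::complex_vector) \<Rightarrow> 'b \<Rightarrow> 'v" where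
  "tensor_lift tens \<A> \<beta> z =
     (THE v. \<exists>(n::nat) x y. (\<forall>i<n. x i \<in> \<A> \<and> y i \<in> \<A>) \<and>
        z = (\<Sum>i<n. tens (x i) (y i)) \<and> v = (\<Sum>i<n. \<beta> (x i) (y i)))"

text \<open>\<open>conv_left\<close> is \<open>\<lambda> \<star> a = (id \<otimes> \<lambda>)\<Delta>(a)\<close>, \<open>conv_right\<close> is \<open>a \<star> \<lambda> = (\<lambda> \<otimes> id)\<Delta>(a)\<close>, and \<open>conv\<close> is
  \<open>\<lambda> \<star> \<mu> = (\<lambda> \<otimes> \<mu>) \<circ> \<Delta>\<close>, for linear functionals on \<open>coefficient_algebra tens \<Delta>\<close>.\<close>

definition conv_left ::
    "('a \<Rightarrow> 'a \<Rightarrow> 'b::cstar_algebra) \<Rightarrow> ('a \<Rightarrow> 'b) \<Rightarrow> ('a::cstar_algebra \<Rightarrow> complex) \<Rightarrow> 'a \<Rightarrow> 'a" where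
  "conv_left tens \<Delta> l a =
     tensor_lift tens (coefficient_algebra tens \<Delta>) (\<lambda>x y. l y *\<^sub>C x) (\<Delta> a)"

definition conv_right ::
    "('a \<Rightarrow> 'a \<Rightarrow> 'b::cstar_algebra) \<Rightarrow> ('a \<Rightarrow> 'b) \<Rightarrow> 'a \<Rightarrow> ('a::cstar_algebra \<Rightarrow> complex) \<Rightarrow> 'a" where
  "conv_right tens \<Delta> a l =
     tensor_lift tens (coefficient_algebra tens \<Delta>) (\<lambda>x y. l x *\<^sub>C y) (\<Delta> a)"

definition conv ::
    "('a \<Rightarrow> 'a \<Rightarrow> 'b::cstar_algebra) \<Rightarrow> ('a \<Rightarrow> 'b) \<Rightarrow>
     ('a::cstar_algebra \<Rightarrow> complex) \<Rightarrow> ('a \<Rightarrow> complex) \<Rightarrow> 'a \<Rightarrow> complex" where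
  "conv tens \<Delta> l m a =
     tensor_lift tens (coefficient_algebra tens \<Delta>) (\<lambda>x y. l x * m y) (\<Delta> a)"

text \<open>The Hopf *-algebra \<open>\<A>\<close> of a compact quantum group together with its counit, antipode, Haar
  state and Woronowicz characters. All of these exist and are unique; they enter as parameters
  constrained by their defining properties. As functions on \<open>A\<close> only their restrictions to \<open>\<A>\<close>
  are relevant. Coassociativity of \<open>\<Delta>\<close> on \<open>\<A>\<close> is inherited from \<open>A\<close>.\<close>

locale cqg_hopf_star_algebra =
  compact_quantum_group tens tens_l tens_r \<Delta>
  for tens :: "'a::cstar_algebra \<Rightarrow> 'a \<Rightarrow> 'b::cstar_algebra"
    and tens_l :: "'b \<Rightarrow> 'a \<Rightarrow> 'c::cstar_algebra"
    and tens_r :: "'a \<Rightarrow> 'b \<Rightarrow> 'c"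
    and \<Delta> :: "'a \<Rightarrow> 'b" +
  fixes \<A> :: "'a set"
    and \<epsilon> :: "'a \<Rightarrow> complex"
    and S :: "'a \<Rightarrow> 'a"
    and h :: "'a \<Rightarrow> complex"
    and f :: "complex \<Rightarrow> 'a \<Rightarrow> complex"
  assumes coefficients: "\<A> = coefficient_algebra tens \<Delta>"
    and dense: "closure \<A> = UNIV"
    and one_closed: "1 \<in> \<A>"
    and mult_closed: "\<lbrakk>a \<in> \<A>; b \<in> \<A>\<rbrakk> \<Longrightarrow> a * b \<in> \<A>"
    and star_closed: "a \<in> \<A> \<Longrightarrow> star a \<in> \<A>"
    and comult_closed: "a \<in> \<A> \<Longrightarrow> \<Delta> a \<in> cspan {tens x y | x y. x \<in> \<A> \<and> y \<in> \<A>}"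
    and counit_linear: "linear_on_subspace \<A> \<epsilon>"
    and counit_one: "\<epsilon> 1 = 1"
    and counit_mult: "\<lbrakk>a \<in> \<A>; b \<in> \<A>\<rbrakk> \<Longrightarrow> \<epsilon> (a * b) = \<epsilon> a * \<epsilon> b"
    and counit_left: "a \<in> \<A> \<Longrightarrow> conv_right tens \<Delta> a \<epsilon> = a"
    and counit_right: "a \<in> \<A> \<Longrightarrow> conv_left tens \<Delta> \<epsilon> a = a"
    and antipode_closed: "a \<in> \<A> \<Longrightarrow> S a \<in> \<A>"
    and antipode_linear: "linear_on_subspace \<A> S"
    and antipode_left: "a \<in> \<A> \<Longrightarrow> tensor_lift tens \<A> (\<lambda>x y. S x * y) (\<Delta> a) = \<epsilon> a *\<^sub>C 1"
    and antipode_right: "a \<in> \<A> \<Longrightarrow> tensor_lift tens \<A> (\<lambda>x y. x * S y) (\<Delta> a) = \<epsilon> a *\<^sub>C 1"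
    and haar_linear: "linear_on_subspace \<A> h"
    and haar_one: "h 1 = 1"
    and haar_positive: "a \<in> \<A> \<Longrightarrow> h (star a * a) \<in> \<real>\<^sub>\<ge>\<^sub>0"
    and haar_left_invariant: "a \<in> \<A> \<Longrightarrow> conv_left tens \<Delta> h a = h a *\<^sub>C 1"
    and haar_right_invariant: "a \<in> \<A> \<Longrightarrow> conv_right tens \<Delta> a h = h a *\<^sub>C 1"
    and woronowicz_linear: "linear_on_subspace \<A> (f z)"
    and woronowicz_mult: "\<lbrakk>a \<in> \<A>; b \<in> \<A>\<rbrakk> \<Longrightarrow> f z (a * b) = f z a * f z b"
    and woronowicz_one: "f z 1 = 1"
    and woronowicz_entire: "a \<in> \<A> \<Longrightarrow> (\<lambda>z. f z a) holomorphic_on UNIV"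
    and woronowicz_zero: "a \<in> \<A> \<Longrightarrow> f 0 a = \<epsilon> a"
    and woronowicz_conv: "a \<in> \<A> \<Longrightarrow> conv tens \<Delta> (f z) (f w) a = f (z + w) a"
    and woronowicz_antipode: "a \<in> \<A> \<Longrightarrow> f z (S a) = f (- z) a"
    and woronowicz_star: "a \<in> \<A> \<Longrightarrow> f (cnj z) (star a) = cnj (f (- z) a)"
    and antipode_squared:
      "a \<in> \<A> \<Longrightarrow> S (S a) = conv_right tens \<Delta> (conv_left tens \<Delta> (f (- 1)) a) (f 1)"
    and haar_modular:
      "\<lbrakk>a \<in> \<A>; b \<in> \<A>\<rbrakk> \<Longrightarrow>
         h (a * b) = h (b * conv_right tens \<Delta> (conv_left tens \<Delta> (f 1) a) (f 1))"

definition unitary_antipode ::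
    "('a \<Rightarrow> 'a \<Rightarrow> 'b::cstar_algebra) \<Rightarrow> ('a \<Rightarrow> 'b) \<Rightarrow> ('a \<Rightarrow> 'a) \<Rightarrow>
     (complex \<Rightarrow> 'a::cstar_algebra \<Rightarrow> complex) \<Rightarrow> 'a \<Rightarrow> 'a" where
  "unitary_antipode tens \<Delta> S f a =
     S (conv_right tens \<Delta> (conv_left tens \<Delta> (f (1/2)) a) (f (- (1/2))))"


section \<open>Generating functionals and Schuermann triples\<close>

definition hermitian_on :: "'a::cstar_algebra set \<Rightarrow> ('a \<Rightarrow> complex) \<Rightarrow> bool" where
  "hermitian_on \<A> \<phi> \<longleftrightarrow> (\<forall>a\<in>\<A>. \<phi> (star a) = cnj (\<phi> a))"

definition generating_functional ::
    "'a::cstar_algebra set \<Rightarrow> ('a \<Rightarrow> complex) \<Rightarrow> ('a \<Rightarrow> complex) \<Rightarrow> bool" where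
  "generating_functional \<A> \<epsilon> \<phi> \<longleftrightarrow>
     linear_on_subspace \<A> \<phi> \<and> hermitian_on \<A> \<phi> \<and> \<phi> 1 = 0 \<and>
     (\<forall>a\<in>\<A>. \<epsilon> a = 0 \<longrightarrow> \<phi> (star a * a) \<in> \<real>\<^sub>\<ge>\<^sub>0)"

definition is_adjoint :: "('d::pre_hilbert \<Rightarrow> 'd) \<Rightarrow> ('d \<Rightarrow> 'd) \<Rightarrow> bool" where
  "is_adjoint T' T \<longleftrightarrow> (\<forall>v w. cinner (T' v) w = cinner v (T w))"

definition adjointable_ops :: "('d::pre_hilbert \<Rightarrow> 'd) set"  (\<open>\<L>\<^sup>#\<close>) where
  "\<L>\<^sup># = {T. clinear T \<and> (\<exists>T'. clinear T' \<and> is_adjoint T' T)}"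

definition unital_star_rep ::
    "'a::cstar_algebra set \<Rightarrow> ('a \<Rightarrow> 'd::pre_hilbert \<Rightarrow> 'd) \<Rightarrow> bool" where
  "unital_star_rep \<A> \<pi> \<longleftrightarrow>
     (\<forall>a\<in>\<A>. \<pi> a \<in> \<L>\<^sup>#) \<and>
     (\<forall>v. linear_on_subspace \<A> (\<lambda>a. \<pi> a v)) \<and>
     \<pi> 1 = id \<and>
     (\<forall>a\<in>\<A>. \<forall>b\<in>\<A>. \<pi> (a * b) = \<pi> a \<circ> \<pi> b) \<and>
     (\<forall>a\<in>\<A>. is_adjoint (\<pi> (star a)) (\<pi> a))"

definition schuermann_triple ::
    "'a::cstar_algebra set \<Rightarrow> ('a \<Rightarrow> complex) \<Rightarrow>
     ('a \<Rightarrow> 'd::pre_hilbert \<Rightarrow> 'd) \<Rightarrow> ('a \<Rightarrow> 'd) \<Rightarrow> ('a \<Rightarrow> complex) \<Rightarrow> bool" where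
  "schuermann_triple \<A> \<epsilon> \<pi> \<eta> \<phi> \<longleftrightarrow>
     unital_star_rep \<A> \<pi> \<and>
     linear_on_subspace \<A> \<eta> \<and>
     (\<forall>a\<in>\<A>. \<forall>b\<in>\<A>. \<eta> (a * b) = \<pi> a (\<eta> b) + \<epsilon> b *\<^sub>C \<eta> a) \<and>
     linear_on_subspace \<A> \<phi> \<and> hermitian_on \<A> \<phi> \<and>
     (\<forall>a\<in>\<A>. \<forall>b\<in>\<A>. \<epsilon> a = 0 \<longrightarrow> \<epsilon> b = 0 \<longrightarrow> \<phi> (a * b) = cinner (\<eta> (star a)) (\<eta> b))"


section \<open>The opposite space and the opposite representation\<close>

text \<open>\<open>Opp v\<close> is the vector written with an overline in the opposite space.\<close>

datatype 'd opposite = Opp (unopp: 'd)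

instantiation opposite :: (complex_vector) complex_vector
begin
definition zero_opposite :: "'a opposite" where "0 = Opp 0"
definition plus_opposite :: "'a opposite \<Rightarrow> 'a opposite \<Rightarrow> 'a opposite" where
  "v + w = Opp (unopp v + unopp w)"
definition uminus_opposite :: "'a opposite \<Rightarrow> 'a opposite" where "- v = Opp (- unopp v)"
definition minus_opposite :: "'a opposite \<Rightarrow> 'a opposite \<Rightarrow> 'a opposite" where
  "v - w = Opp (unopp v - unopp w)"
definition scaleR_opposite :: "real \<Rightarrow> 'a opposite \<Rightarrow> 'a opposite" where
  "r *\<^sub>R v = Opp (r *\<^sub>R unopp v)"
definition scaleC_opposite :: "complex \<Rightarrow> 'a opposite \<Rightarrow> 'a opposite" where
  "c *\<^sub>C v = Opp (cnj c *\<^sub>C unopp v)"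
instance
  by standard
    (simp_all add: zero_opposite_def plus_opposite_def uminus_opposite_def minus_opposite_def
      scaleR_opposite_def scaleC_opposite_def scaleR_scaleC scaleC_add_right scaleC_add_left
      scaleC_scaleC scaleC_one ac_simps)
end

instantiation opposite :: (pre_hilbert) pre_hilbert
begin
definition cinner_opposite :: "'a opposite \<Rightarrow> 'a opposite \<Rightarrow> complex" where
  "cinner v w = cinner (unopp w) (unopp v)"
instance
proof
  fix v w w' :: "'a opposite" and c :: complex
  show "cinner v w = cnj (cinner w v)"
    unfolding cinner_opposite_def by (rule cinner_commute)
  have "cinner (unopp w + unopp w') (unopp v) = cnj (cinner (unopp v) (unopp w + unopp w'))"
    by (rule cinner_commute)
  then show "cinner v (w + w') = cinner v w + cinner v w'"
    by (simp add: cinner_opposite_def plus_opposite_def cinner_add_right cinner_commute[symmetric])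
  have "cinner (cnj c *\<^sub>C unopp w) (unopp v) = cnj (cinner (unopp v) (cnj c *\<^sub>C unopp w))"
    by (rule cinner_commute)
  then show "cinner v (c *\<^sub>C w) = c * cinner v w"
    by (simp add: cinner_opposite_def scaleC_opposite_def cinner_scaleC_right
        cinner_commute[symmetric])
  show "cinner v v \<in> \<real>\<^sub>\<ge>\<^sub>0"
    by (simp add: cinner_opposite_def cinner_nonneg)
  show "cinner v v = 0 \<longleftrightarrow> v = 0"
    by (cases v) (simp add: cinner_opposite_def zero_opposite_def cinner_eq_zero_iff)
qed
end

definition opposite_rep ::
    "('a \<Rightarrow> 'a) \<Rightarrow> ('a::cstar_algebra \<Rightarrow> 'd \<Rightarrow> 'd) \<Rightarrow> 'a \<Rightarrow> 'd opposite \<Rightarrow> 'd opposite" where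
  "opposite_rep R \<pi> a v = Opp (\<pi> (R (star a)) (unopp v))"

definition opposite_cocycle ::
    "('a \<Rightarrow> 'a) \<Rightarrow> ('a::cstar_algebra \<Rightarrow> 'd) \<Rightarrow> 'a \<Rightarrow> 'd opposite" where
  "opposite_cocycle R \<eta> a = Opp (\<eta> (R (star a)))"

end

theory Submission
  imports Defs
begin

text \<open>
  The unitary antipode \<open>R\<close> is a unital, linear, antimultiplicative map on \<open>\<A>\<close> that commutes with
  the involution and preserves the counit. The map \<open>a \<mapsto> R (star a)\<close> is therefore antilinear and
  multiplicative, and the opposite space turns antilinear maps into linear ones. So
  \<open>a \<mapsto> \<pi> (R (star a))\<close> is linear and multiplicative on the opposite space, and the cocycle identity
  for \<open>\<eta> (R (star a))\<close> is the one for \<open>\<eta>\<close> at the elements \<open>R (star a)\<close> and \<open>R (star b)\<close>. The order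
  reversal in \<open>R (a * b) = R b * R a\<close> is matched by the exchange of the two arguments in the
  opposite inner product. Positivity of \<open>\<phi> \<circ> R\<close> holds because
  \<open>R (star a * a) = star c * c\<close> with \<open>c = R (star a)\<close>, which lies in the kernel of the counit
  whenever \<open>a\<close> does.

  The properties of \<open>R\<close> have to be derived from the axioms of the Hopf *-algebra. Since \<open>\<A>\<close> is spanned
  by the coefficients of unitary corepresentations \<open>u\<close>, they can be checked on coefficients,
  where they become matrix identities. The convolution with a functional multiplies \<open>u\<close> by a
  scalar matrix (\<open>conv_left_matrix\<close>, \<open>conv_right_matrix\<close>), coassociativity becomes
  associativity of the matrix product, and \<open>S (u i j) = star (u j i)\<close> (\<open>antipode_corep\<close>),
  because both matrices are inverse to \<open>u\<close>.
  \<^item> Antimultiplicativity: products of coefficients of \<open>u\<close> and \<open>v\<close> are the coefficients of the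
    tensor product corepresentation, for which \<open>unitary_antipode_corep\<close> gives \<open>R\<close> explicitly.
  \<^item> Compatibility with the involution: put \<open>T\<^sub>z a = f\<^sub>z \<star> a \<star> f\<^sub>-\<^sub>z\<close>, so that \<open>R = S \<circ> T\<^sub>1\<^sub>/\<^sub>2\<close> and
    \<open>S \<circ> S = T\<^sub>-\<^sub>1\<close>. The \<open>T\<^sub>z\<close> form a one-parameter group, and the involution exchanges \<open>T\<^sub>1\<^sub>/\<^sub>2\<close> with
    \<open>T\<^sub>-\<^sub>1\<^sub>/\<^sub>2\<close>. Together with \<open>S (star (S b)) = star b\<close> this gives
    \<open>S (star (R a)) = T\<^sub>-\<^sub>1\<^sub>/\<^sub>2 (star a) = T\<^sub>-\<^sub>1 (T\<^sub>1\<^sub>/\<^sub>2 (star a)) = S (R (star a))\<close>, and \<open>S\<close> is injective.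
\<close>

section \<open>Linear maps on subspaces\<close>

lemma linear_on_subspace_add:
  "linear_on_subspace V F \<Longrightarrow> x \<in> V \<Longrightarrow> y \<in> V \<Longrightarrow> F (x + y) = F x + F y"
  by (simp add: linear_on_subspace_def)

lemma linear_on_subspace_scaleC:
  "linear_on_subspace V F \<Longrightarrow> x \<in> V \<Longrightarrow> F (c *\<^sub>C x) = c *\<^sub>C F x"
  by (simp add: linear_on_subspace_def)

lemma linear_on_subspace_zero:
  assumes "linear_on_subspace V F" "csubspace V"
  shows "F 0 = 0"
  using linear_on_subspace_scaleC[OF assms(1) complex_vector.subspace_0[OF assms(2)], of 0] by simp

lemma linear_on_subspace_sum:
  assumes "linear_on_subspace V F" "csubspace V" "\<And>i. i \<in> I \<Longrightarrow> x i \<in> V"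
  shows "F (\<Sum>i\<in>I. x i) = (\<Sum>i\<in>I. F (x i))"
  using assms(3)
proof (induction I rule: infinite_finite_induct)
  case (insert i I)
  then show ?case
    by (simp add: linear_on_subspace_add[OF assms(1)] complex_vector.subspace_sum[OF assms(2)])
qed (simp_all add: linear_on_subspace_zero[OF assms(1,2)])

lemma linear_on_subspace_combination:
  assumes "linear_on_subspace V F" "csubspace V" "\<And>i. i \<in> I \<Longrightarrow> x i \<in> V"
  shows "F (\<Sum>i\<in>I. c i *\<^sub>C x i) = (\<Sum>i\<in>I. c i *\<^sub>C F (x i))"
proof -
  have "F (\<Sum>i\<in>I. c i *\<^sub>C x i) = (\<Sum>i\<in>I. F (c i *\<^sub>C x i))"
    using assms by (intro linear_on_subspace_sum) (auto intro: complex_vector.subspace_scale)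
  also have "\<dots> = (\<Sum>i\<in>I. c i *\<^sub>C F (x i))"
    using assms by (intro sum.cong) (auto simp: linear_on_subspace_scaleC)
  finally show ?thesis .
qed

definition bilinear_on ::
    "'a::complex_vector set \<Rightarrow> ('a \<Rightarrow> 'a \<Rightarrow> 'v::complex_vector) \<Rightarrow> bool" where
  "bilinear_on V \<beta> \<longleftrightarrow>
     (\<forall>y\<in>V. linear_on_subspace V (\<lambda>x. \<beta> x y)) \<and> (\<forall>x\<in>V. linear_on_subspace V (\<beta> x))"

section \<open>Linear maps on algebraic tensor products\<close>

lemma cstar_star_zero [simp]: "star (0 :: 'a::cstar_algebra) = 0"
  using star_scaleC[of 0 "0 :: 'a"] by simp

lemma cstar_star_one [simp]: "star (1 :: 'a::cstar_algebra) = 1"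
  by (metis mult_1 star_mult star_star mult_1_right)

lemma cstar_star_sum: "star (\<Sum>i\<in>I. x i) = (\<Sum>i\<in>I. star (x i :: 'a::cstar_algebra))"
  by (induction I rule: infinite_finite_induct) (simp_all add: star_add)

context minimal_tensor_product
begin

lemma tens_add_left: "tens (a + a') b = tens a b + tens a' b"
  and tens_scaleC_left: "tens (c *\<^sub>C a) b = c *\<^sub>C tens a b"
  and tens_add_right: "tens a (b + b') = tens a b + tens a b'"
  and tens_scaleC_right: "tens a (c *\<^sub>C b) = c *\<^sub>C tens a b"
  using tens_linear_left[of b] tens_linear_right[of a] by (simp_all add: Vector_Spaces.linear_iff)

lemma tens_zero_left: "tens 0 b = 0"
  using tens_scaleC_left[of 0 0 b] by simp

lemma tens_minus_left: "tens (- a) b = - tens a b"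
  using tens_scaleC_left[of "- 1" a b] by simp

lemma tens_sum_left: "tens (\<Sum>i\<in>I. x i) b = (\<Sum>i\<in>I. tens (x i) b)"
  by (induction I rule: infinite_finite_induct) (simp_all add: tens_zero_left tens_add_left)

text \<open>Injectivity of the tensor product for families over any finite index set, so that later index
  sets can be subsets, disjoint sums and products.\<close>

lemma tens_injective_finite:
  assumes I: "finite I"
    and indep: "\<And>c. (\<Sum>i\<in>I. c i *\<^sub>C x i) = 0 \<Longrightarrow> \<forall>i\<in>I. c i = 0"
    and zero: "(\<Sum>i\<in>I. tens (x i) (y i)) = 0"
    and i: "i \<in> I"
  shows "y i = 0"
proof -
  obtain e where e: "bij_betw e {0..<card I} I" using ex_bij_betw_nat_finite[OF I] by blast
  then have e': "bij_betw e {..<card I} I" by (simp add: atLeast0LessThan)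
  let ?e' = "the_inv_into {..<card I} e"
  have "\<forall>k<card I. y (e k) = 0"
  proof (rule tens_injective)
    fix c :: "nat \<Rightarrow> complex"
    assume c: "(\<Sum>k<card I. c k *\<^sub>C x (e k)) = 0"
    have "(\<Sum>i\<in>I. c (?e' i) *\<^sub>C x i) = (\<Sum>k<card I. c (?e' (e k)) *\<^sub>C x (e k))"
      by (rule sum.reindex_bij_betw[OF e', symmetric])
    also have "\<dots> = (\<Sum>k<card I. c k *\<^sub>C x (e k))"
      using e' by (intro sum.cong) (auto simp: the_inv_into_f_f bij_betw_def)
    finally have "\<forall>i\<in>I. c (?e' i) = 0" using c indep[of "\<lambda>i. c (?e' i)"] by simp
    then have "c (?e' (e k)) = 0" if "k < card I" for k
      using e' that by (auto simp: bij_betw_def)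
    then show "\<forall>k<card I. c k = 0"
      using e' by (auto simp: bij_betw_def the_inv_into_f_f)
  next
    show "(\<Sum>k<card I. tens (x (e k)) (y (e k))) = 0"
      using zero sum.reindex_bij_betw[OF e', of "\<lambda>i. tens (x i) (y i)"] by simp
  qed
  then show ?thesis using i e' unfolding bij_betw_def by (metis imageE lessThan_iff)
qed

text \<open>This is the universal property of the algebraic tensor product inside \<open>'c\<close>. If the \<open>x i\<close> are
  independent, injectivity forces every \<open>y i\<close> to vanish. Otherwise some \<open>x k\<close> is a combination of the
  other ones; moving it to the right factors gives a shorter relation with the same image under
  \<open>\<beta>\<close>, so induction on the index set applies.\<close>

lemma bilinear_respects_tens_relations:
  fixes \<beta> :: "'a \<Rightarrow> 'b \<Rightarrow> 'v::complex_vector"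
  assumes U: "csubspace U" and V: "csubspace V"
    and left: "\<And>y. y \<in> V \<Longrightarrow> linear_on_subspace U (\<lambda>x. \<beta> x y)"
    and right: "\<And>x. x \<in> U \<Longrightarrow> linear_on_subspace V (\<beta> x)"
    and "finite I" "\<And>i. i \<in> I \<Longrightarrow> x i \<in> U" "\<And>i. i \<in> I \<Longrightarrow> y i \<in> V"
    and "(\<Sum>i\<in>I. tens (x i) (y i)) = 0"
  shows "(\<Sum>i\<in>I. \<beta> (x i) (y i)) = 0"
  using assms(5-)
proof (induction I arbitrary: y rule: finite_psubset_induct)
  case (psubset I)
  show ?case
  proof (cases "\<forall>c. (\<Sum>i\<in>I. c i *\<^sub>C x i) = 0 \<longrightarrow> (\<forall>i\<in>I. c i = 0)")
    case True
    then have "y i = 0" if "i \<in> I" for i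
      using tens_injective_finite[of I x y i] psubset.hyps psubset.prems that by blast
    then show ?thesis
      using linear_on_subspace_zero[OF right V] psubset.prems(1) by simp
  next
    case False
    then obtain c k where c: "(\<Sum>i\<in>I. c i *\<^sub>C x i) = 0" and k: "k \<in> I" "c k \<noteq> 0" by blast
    define J where "J = I - {k}"
    define d where "d i = - (c i / c k)" for i
    have J: "finite J" "J \<subset> I" "\<And>i. i \<in> J \<Longrightarrow> i \<in> I" using psubset.hyps k by (auto simp: J_def)
    note split = sum.remove[OF psubset.hyps k(1), folded J_def]
    have "x k = (\<Sum>i\<in>J. d i *\<^sub>C x i)"
    proof -
      have "c k *\<^sub>C x k = - (\<Sum>i\<in>J. c i *\<^sub>C x i)"
        using c split[of "\<lambda>i. c i *\<^sub>C x i"] by (simp add: add_eq_0_iff2)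
      then have "(1 / c k) *\<^sub>C c k *\<^sub>C x k = (1 / c k) *\<^sub>C (- (\<Sum>i\<in>J. c i *\<^sub>C x i))" by simp
      then show ?thesis
        using k(2) by (simp add: d_def complex_vector.scale_sum_right scaleC_one sum_negf)
    qed
    note xk = this
    \<comment> \<open>the right factors after \<open>x k\<close> has been expanded in the other \<open>x i\<close>\<close>
    define y' where "y' i = y i + d i *\<^sub>C y k" for i
    have y': "y' i \<in> V" if "i \<in> J" for i
      using that J k psubset.prems(2) V
      by (auto simp: y'_def intro!: complex_vector.subspace_add complex_vector.subspace_scale)
    have "(\<Sum>i\<in>J. tens (x i) (y' i)) = 0"
    proof -
      have "(\<Sum>i\<in>I. tens (x i) (y i)) = (\<Sum>i\<in>J. tens (x i) (y' i))"
        by (simp add: split xk tens_sum_left y'_def tens_add_right tens_scaleC_left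
            tens_scaleC_right sum.distrib)
      then show ?thesis using psubset.prems(3) by simp
    qed
    then have "(\<Sum>i\<in>J. \<beta> (x i) (y' i)) = 0"
      using psubset.IH[OF J(2), of y'] psubset.prems(1) y' J(3) by blast
    moreover have "(\<Sum>i\<in>I. \<beta> (x i) (y i)) = (\<Sum>i\<in>J. \<beta> (x i) (y' i))"
    proof -
      have "\<beta> (x k) (y k) = (\<Sum>i\<in>J. d i *\<^sub>C \<beta> (x i) (y k))"
        unfolding xk using J(3) k(1) psubset.prems(1,2)
        by (intro linear_on_subspace_combination[OF left U]) auto
      moreover have "\<beta> (x i) (y' i) = \<beta> (x i) (y i) + d i *\<^sub>C \<beta> (x i) (y k)" if "i \<in> J" for i
        using that J(3) k(1) psubset.prems(1,2) right[of "x i"] V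
        by (simp add: y'_def linear_on_subspace_add linear_on_subspace_scaleC
            complex_vector.subspace_scale)
      ultimately show ?thesis by (simp add: split sum.distrib)
    qed
    ultimately show ?thesis by simp
  qed
qed

end

text \<open>Two representations of the same tensor differ by a relation indexed by the disjoint sum of
  their index sets, and \<open>bilinear_respects_tens_relations\<close> says that \<open>\<beta>\<close> respects it.\<close>

lemma tensor_lift_eq:
  fixes tens :: "'a::cstar_algebra \<Rightarrow> 'a \<Rightarrow> 'b::cstar_algebra"
    and \<beta> :: "'a \<Rightarrow> 'a \<Rightarrow> 'v::complex_vector"
  assumes tp: "minimal_tensor_product tens"
    and V: "csubspace V" and \<beta>: "bilinear_on V \<beta>"
    and I: "finite I" "\<And>i. i \<in> I \<Longrightarrow> x i \<in> V" "\<And>i. i \<in> I \<Longrightarrow> y i \<in> V"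
  shows "tensor_lift tens V \<beta> (\<Sum>i\<in>I. tens (x i) (y i)) = (\<Sum>i\<in>I. \<beta> (x i) (y i))"
  unfolding tensor_lift_def
proof (rule the_equality)
  interpret minimal_tensor_product tens by (fact tp)
  obtain e where "bij_betw e {0..<card I} I" using ex_bij_betw_nat_finite[OF I(1)] by blast
  then have e: "bij_betw e {..<card I} I" by (simp add: atLeast0LessThan)
  have "\<forall>i<card I. x (e i) \<in> V \<and> y (e i) \<in> V" using e I by (auto simp: bij_betw_def)
  then show "\<exists>(n::nat) x' y'. (\<forall>i<n. x' i \<in> V \<and> y' i \<in> V) \<and>
      (\<Sum>i\<in>I. tens (x i) (y i)) = (\<Sum>i<n. tens (x' i) (y' i)) \<and>
      (\<Sum>i\<in>I. \<beta> (x i) (y i)) = (\<Sum>i<n. \<beta> (x' i) (y' i))"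
    using sum.reindex_bij_betw[OF e, of "\<lambda>i. tens (x i) (y i)"]
      sum.reindex_bij_betw[OF e, of "\<lambda>i. \<beta> (x i) (y i)"]
    by (intro exI[of _ "card I"] exI[of _ "\<lambda>i. x (e i)"] exI[of _ "\<lambda>i. y (e i)"]) auto
next
  interpret minimal_tensor_product tens by (fact tp)
  fix v
  assume "\<exists>(n::nat) x' y'. (\<forall>i<n. x' i \<in> V \<and> y' i \<in> V) \<and>
      (\<Sum>i\<in>I. tens (x i) (y i)) = (\<Sum>i<n. tens (x' i) (y' i)) \<and>
      v = (\<Sum>i<n. \<beta> (x' i) (y' i))"
  then obtain n :: nat and x' y' where V': "\<And>i. i < n \<Longrightarrow> x' i \<in> V" "\<And>i. i < n \<Longrightarrow> y' i \<in> V"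
    and eq: "(\<Sum>i\<in>I. tens (x i) (y i)) = (\<Sum>i<n. tens (x' i) (y' i))"
    and v: "v = (\<Sum>i<n. \<beta> (x' i) (y' i))" by blast
  have left: "linear_on_subspace V (\<lambda>x. \<beta> x y)" if "y \<in> V" for y
    using \<beta> that by (simp add: bilinear_on_def)
  have right: "linear_on_subspace V (\<beta> x)" if "x \<in> V" for x
    using \<beta> that by (simp add: bilinear_on_def)
  define X where "X = case_sum x (\<lambda>i. (- 1) *\<^sub>C x' i)"
  define Y where "Y = case_sum y y'"
  have "(\<Sum>p\<in>I <+> {..<n}. \<beta> (X p) (Y p)) = 0"
  proof (rule bilinear_respects_tens_relations[OF V V left right])
    show "(\<Sum>p\<in>I <+> {..<n}. tens (X p) (Y p)) = 0"
      using I(1) by (simp add: sum.Plus X_def Y_def tens_minus_left eq sum_negf)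
  next
    fix p assume "p \<in> I <+> {..<n}"
    then show "X p \<in> V" "Y p \<in> V"
      using I V' complex_vector.subspace_scale[OF V, of _ "- 1"]
      by (auto simp del: complex_vector.scale_minus_left simp: X_def Y_def)
  qed (use I in auto)
  moreover have "\<beta> (- x' i) (y' i) = - \<beta> (x' i) (y' i)" if "i < n" for i
    using linear_on_subspace_scaleC[OF left, of "y' i" "x' i" "- 1"] V' that by simp
  ultimately show "v = (\<Sum>i\<in>I. \<beta> (x i) (y i))"
    using I(1) by (simp add: sum.Plus X_def Y_def v sum_negf)
qed

section \<open>Convolution on the coefficient algebra\<close>

context cqg_hopf_star_algebra
begin

lemma subspace: "csubspace \<A>"
  unfolding coefficients coefficient_algebra_def by (rule complex_vector.subspace_span)

lemmas closed = one_closed mult_closed star_closed antipode_closed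
  complex_vector.subspace_add[OF subspace] complex_vector.subspace_scale[OF subspace]
  complex_vector.subspace_sum[OF subspace]

lemma tensor_product: "minimal_tensor_product tens"
  by (rule tens.minimal_tensor_product_axioms)

lemmas lift_eq = tensor_lift_eq[OF tensor_product subspace]

lemma comult_decomposition:
  assumes "a \<in> \<A>"
  obtains I :: "'b set" and x y where "finite I" "\<forall>i\<in>I. x i \<in> \<A>" "\<forall>i\<in>I. y i \<in> \<A>"
    "\<Delta> a = (\<Sum>i\<in>I. tens (x i) (y i))"
proof -
  obtain I r where I: "finite I" "I \<subseteq> {tens x y | x y. x \<in> \<A> \<and> y \<in> \<A>}"
    and eq: "\<Delta> a = (\<Sum>z\<in>I. r z *\<^sub>C z)"
    using comult_closed[OF assms] unfolding complex_vector.span_explicit by blast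
  from I(2) have "\<forall>z\<in>I. \<exists>x y. x \<in> \<A> \<and> y \<in> \<A> \<and> z = tens x y" by blast
  then obtain x y where xy: "\<And>z. z \<in> I \<Longrightarrow> x z \<in> \<A> \<and> y z \<in> \<A> \<and> z = tens (x z) (y z)" by metis
  show ?thesis
  proof (rule that[of I "\<lambda>z. r z *\<^sub>C x z" y])
    show "\<Delta> a = (\<Sum>i\<in>I. tens (r i *\<^sub>C x i) (y i))"
      unfolding eq using xy by (intro sum.cong) (auto simp: tens.tens_scaleC_left)
  qed (use I xy in \<open>auto intro: closed\<close>)
qed

lemma lift_comult_linear:
  fixes \<beta> :: "'a \<Rightarrow> 'a \<Rightarrow> 'v::complex_vector"
  assumes \<beta>: "bilinear_on \<A> \<beta>"
  shows "linear_on_subspace \<A> (\<lambda>a. tensor_lift tens \<A> \<beta> (\<Delta> a))"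
  unfolding linear_on_subspace_def
proof (intro conjI ballI allI)
  have \<Delta>: "\<Delta> (a + b) = \<Delta> a + \<Delta> b" "\<Delta> (c *\<^sub>C a) = c *\<^sub>C \<Delta> a" for a b c
    using comult_hom by (simp_all add: unital_star_hom_def Vector_Spaces.linear_iff)
  {
    fix a b assume ab: "a \<in> \<A>" "b \<in> \<A>"
    obtain I :: "'b set" and x y where a: "finite I" "\<forall>i\<in>I. x i \<in> \<A>" "\<forall>i\<in>I. y i \<in> \<A>"
      "\<Delta> a = (\<Sum>i\<in>I. tens (x i) (y i))" using comult_decomposition[OF ab(1)] by blast
    obtain J :: "'b set" and x' y' where b: "finite J" "\<forall>i\<in>J. x' i \<in> \<A>" "\<forall>i\<in>J. y' i \<in> \<A>"
      "\<Delta> b = (\<Sum>i\<in>J. tens (x' i) (y' i))" using comult_decomposition[OF ab(2)] by blast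
    have "\<Delta> (a + b) = (\<Sum>p\<in>I <+> J. tens (case_sum x x' p) (case_sum y y' p))"
      using a(1) b(1) by (simp add: \<Delta> a(4) b(4) sum.Plus)
    then have "tensor_lift tens \<A> \<beta> (\<Delta> (a + b)) =
        (\<Sum>p\<in>I <+> J. \<beta> (case_sum x x' p) (case_sum y y' p))"
      using a b by (simp only:, intro lift_eq[OF \<beta>]) auto
    then show "tensor_lift tens \<A> \<beta> (\<Delta> (a + b)) =
        tensor_lift tens \<A> \<beta> (\<Delta> a) + tensor_lift tens \<A> \<beta> (\<Delta> b)"
      using a b by (simp add: lift_eq[OF \<beta>] sum.Plus)
  }
  fix c a assume "a \<in> \<A>"
  then obtain I :: "'b set" and x y where a: "finite I" "\<forall>i\<in>I. x i \<in> \<A>" "\<forall>i\<in>I. y i \<in> \<A>"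
    "\<Delta> a = (\<Sum>i\<in>I. tens (x i) (y i))" using comult_decomposition by blast
  have "\<Delta> (c *\<^sub>C a) = (\<Sum>i\<in>I. tens (c *\<^sub>C x i) (y i))"
    by (simp add: \<Delta> a(4) tens.tens_scaleC_left complex_vector.scale_sum_right)
  then have "tensor_lift tens \<A> \<beta> (\<Delta> (c *\<^sub>C a)) = (\<Sum>i\<in>I. \<beta> (c *\<^sub>C x i) (y i))"
    using a by (simp only:, intro lift_eq[OF \<beta>]) (auto intro: closed)
  also have "\<dots> = (\<Sum>i\<in>I. c *\<^sub>C \<beta> (x i) (y i))"
    using a \<beta> by (intro sum.cong) (auto simp: bilinear_on_def linear_on_subspace_def)
  finally show "tensor_lift tens \<A> \<beta> (\<Delta> (c *\<^sub>C a)) = c *\<^sub>C tensor_lift tens \<A> \<beta> (\<Delta> a)"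
    using a by (simp add: lift_eq[OF \<beta>] complex_vector.scale_sum_right)
qed

lemma bilinear_on_functional_right:
  "linear_on_subspace \<A> l \<Longrightarrow> bilinear_on \<A> (\<lambda>x y. l y *\<^sub>C x)"
  and bilinear_on_functional_left:
  "linear_on_subspace \<A> l \<Longrightarrow> bilinear_on \<A> (\<lambda>x y. l x *\<^sub>C y)"
  by (auto simp: bilinear_on_def linear_on_subspace_def scaleC_add_left scaleC_add_right
      scaleC_scaleC scaleC_complex_def mult.commute)

lemma bilinear_on_functionals:
  fixes l m :: "'a \<Rightarrow> complex"
  shows "linear_on_subspace \<A> l \<Longrightarrow> linear_on_subspace \<A> m \<Longrightarrow> bilinear_on \<A> (\<lambda>x y. l x * m y)"
  by (auto simp: bilinear_on_def linear_on_subspace_def scaleC_complex_def algebra_simps)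

lemma bilinear_on_antipode_mult: "bilinear_on \<A> (\<lambda>x y. S x * y)"
  using antipode_linear
  by (auto simp: bilinear_on_def linear_on_subspace_def algebra_simps scaleC_mult_left
      scaleC_mult_right)

lemma conv_left_linear:
  "linear_on_subspace \<A> l \<Longrightarrow> linear_on_subspace \<A> (conv_left tens \<Delta> l)"
  using lift_comult_linear[OF bilinear_on_functional_right]
  by (simp add: conv_left_def[abs_def] coefficients[symmetric])

lemma conv_right_linear:
  "linear_on_subspace \<A> l \<Longrightarrow> linear_on_subspace \<A> (\<lambda>a. conv_right tens \<Delta> a l)"
  using lift_comult_linear[OF bilinear_on_functional_left]
  by (simp add: conv_right_def[abs_def] coefficients[symmetric])

lemma conv_left_closed:
  assumes "linear_on_subspace \<A> l" "a \<in> \<A>"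
  shows "conv_left tens \<Delta> l a \<in> \<A>"
proof -
  obtain I :: "'b set" and x y where a: "finite I" "\<forall>i\<in>I. x i \<in> \<A>" "\<forall>i\<in>I. y i \<in> \<A>"
    "\<Delta> a = (\<Sum>i\<in>I. tens (x i) (y i))" using comult_decomposition[OF assms(2)] by blast
  then show ?thesis
    by (simp add: conv_left_def coefficients[symmetric] closed
        lift_eq[OF bilinear_on_functional_right[OF assms(1)]])
qed

lemma conv_right_closed:
  assumes "linear_on_subspace \<A> l" "a \<in> \<A>"
  shows "conv_right tens \<Delta> a l \<in> \<A>"
proof -
  obtain I :: "'b set" and x y where a: "finite I" "\<forall>i\<in>I. x i \<in> \<A>" "\<forall>i\<in>I. y i \<in> \<A>"
    "\<Delta> a = (\<Sum>i\<in>I. tens (x i) (y i))" using comult_decomposition[OF assms(2)] by blast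
  then show ?thesis
    by (simp add: conv_right_def coefficients[symmetric] closed
        lift_eq[OF bilinear_on_functional_left[OF assms(1)]])
qed

section \<open>Matrices of coefficients\<close>

text \<open>Finite-dimensional corepresentations in matrix form that need not be unitary. Entrywise
  adjoints stay in this class, while they need not preserve unitarity.\<close>

definition comult_matrix :: "'i set \<Rightarrow> ('i \<Rightarrow> 'i \<Rightarrow> 'a) \<Rightarrow> bool" where
  "comult_matrix I u \<longleftrightarrow> finite I \<and> (\<forall>i\<in>I. \<forall>j\<in>I. u i j \<in> \<A> \<and>
     \<Delta> (u i j) = (\<Sum>k\<in>I. tens (u i k) (u k j)))"

text \<open>Unitary corepresentations over an arbitrary finite index set; a tensor product of two of
  them is then simply indexed by pairs.\<close>

definition corep_matrix :: "'i set \<Rightarrow> ('i \<Rightarrow> 'i \<Rightarrow> 'a) \<Rightarrow> bool" where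
  "corep_matrix I u \<longleftrightarrow> comult_matrix I u \<and> (\<forall>i\<in>I. \<forall>j\<in>I.
     (\<Sum>k\<in>I. star (u k i) * u k j) = (if i = j then 1 else 0) \<and>
     (\<Sum>k\<in>I. u i k * star (u j k)) = (if i = j then 1 else 0))"

lemma corep_comult: "corep_matrix I u \<Longrightarrow> comult_matrix I u"
  by (simp add: corep_matrix_def)

lemma comult_matrixD:
  assumes "comult_matrix I u" "i \<in> I" "j \<in> I"
  shows "finite I" "u i j \<in> \<A>" "\<Delta> (u i j) = (\<Sum>k\<in>I. tens (u i k) (u k j))"
  using assms by (simp_all add: comult_matrix_def)

lemma corep_matrixD:
  assumes "corep_matrix I u" "i \<in> I" "j \<in> I"
  shows "finite I" "u i j \<in> \<A>" "\<Delta> (u i j) = (\<Sum>k\<in>I. tens (u i k) (u k j))"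
    "(\<Sum>k\<in>I. star (u k i) * u k j) = (if i = j then 1 else 0)"
    "(\<Sum>k\<in>I. u i k * star (u j k)) = (if i = j then 1 else 0)"
  using assms by (simp_all add: corep_matrix_def comult_matrix_def)

lemma corep_matrix_one: "corep_matrix {i} (\<lambda>_ _. 1)"
  using comult_hom one_closed
  by (simp add: corep_matrix_def comult_matrix_def tens.tens_one unital_star_hom_def)

lemma comult_star: "\<Delta> (star a) = star (\<Delta> a)"
  and comult_mult: "\<Delta> (a * b) = \<Delta> a * \<Delta> b"
  using comult_hom by (simp_all add: unital_star_hom_def)

lemma comult_matrix_star:
  "comult_matrix I u \<Longrightarrow> comult_matrix I (\<lambda>i j. star (u i j))"
  by (simp add: comult_matrix_def comult_star cstar_star_sum tens.tens_star star_closed)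

lemma corep_matrix_product:
  assumes u: "corep_matrix I u" and v: "corep_matrix J v"
  shows "corep_matrix (I \<times> J) (\<lambda>(i, p) (j, q). u i j * v p q)"
proof -
  have fin: "finite (I \<times> J)"
    using u v by (simp add: corep_matrix_def comult_matrix_def)
  moreover have "u i j * v p q \<in> \<A>" if "i \<in> I" "j \<in> I" "p \<in> J" "q \<in> J" for i j p q
    using that corep_matrixD(2)[OF u] corep_matrixD(2)[OF v] mult_closed by blast
  moreover have "\<Delta> (u i j * v p q) =
      (\<Sum>(k, m)\<in>I \<times> J. tens (u i k * v p m) (u k j * v m q))"
    if "i \<in> I" "j \<in> I" "p \<in> J" "q \<in> J" for i j p q
    using that
    by (simp add: comult_mult corep_matrixD(3)[OF u] corep_matrixD(3)[OF v] sum_product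
        tens.tens_mult sum.cartesian_product)
  moreover have "(\<Sum>(k, m)\<in>I \<times> J. star (u k i * v m p) * (u k j * v m q)) =
      (if i = j \<and> p = q then 1 else 0)"
    if "i \<in> I" "j \<in> I" "p \<in> J" "q \<in> J" for i j p q
  proof -
    have "(\<Sum>(k, m)\<in>I \<times> J. star (u k i * v m p) * (u k j * v m q)) =
        (\<Sum>k\<in>I. \<Sum>m\<in>J. star (v m p) * (star (u k i) * u k j) * v m q)"
      by (simp add: sum.cartesian_product star_mult mult.assoc)
    also have "\<dots> = (\<Sum>m\<in>J. star (v m p) * (\<Sum>k\<in>I. star (u k i) * u k j) * v m q)"
      by (subst sum.swap) (simp add: sum_distrib_left sum_distrib_right)
    also have "\<dots> = (if i = j \<and> p = q then 1 else 0)"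
      using that by (simp add: corep_matrixD(4)[OF u] corep_matrixD(4)[OF v])
    finally show ?thesis .
  qed
  moreover have "(\<Sum>(k, m)\<in>I \<times> J. (u i k * v p m) * star (u j k * v q m)) =
      (if i = j \<and> p = q then 1 else 0)"
    if "i \<in> I" "j \<in> I" "p \<in> J" "q \<in> J" for i j p q
  proof -
    have "(\<Sum>(k, m)\<in>I \<times> J. (u i k * v p m) * star (u j k * v q m)) =
        (\<Sum>k\<in>I. u i k * (\<Sum>m\<in>J. v p m * star (v q m)) * star (u j k))"
      by (simp add: sum.cartesian_product[symmetric] star_mult mult.assoc sum_distrib_left
          sum_distrib_right)
    also have "\<dots> = (if i = j \<and> p = q then 1 else 0)"
      using that by (simp add: corep_matrixD(5)[OF u] corep_matrixD(5)[OF v])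
    finally show ?thesis .
  qed
  ultimately show ?thesis
    by (auto simp: corep_matrix_def comult_matrix_def split_def)
qed

lemma coefficients_span:
  "\<A> = cspan {u i j | (u :: nat \<Rightarrow> nat \<Rightarrow> 'a) I i j. corep_matrix I u \<and> i \<in> I \<and> j \<in> I}"
proof -
  have "corep_matrix {..<n} u" if "unitary_corep tens \<Delta> n u" for n u
  proof -
    have "u i j \<in> \<A>" if "i < n" "j < n" for i j
      unfolding coefficients coefficient_algebra_def
      using \<open>unitary_corep tens \<Delta> n u\<close> that by (intro complex_vector.span_base) blast
    then show ?thesis using that by (simp add: corep_matrix_def comult_matrix_def unitary_corep_def)
  qed
  then have "{u i j | n u i j. unitary_corep tens \<Delta> n u \<and> i < n \<and> j < n}
      \<subseteq> {u i j | (u :: nat \<Rightarrow> nat \<Rightarrow> 'a) I i j. corep_matrix I u \<and> i \<in> I \<and> j \<in> I}"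
    by (smt (verit) Collect_mono lessThan_iff)
  then have "\<A> \<subseteq> cspan {u i j | (u :: nat \<Rightarrow> nat \<Rightarrow> 'a) I i j. corep_matrix I u \<and> i \<in> I \<and> j \<in> I}"
    unfolding coefficients coefficient_algebra_def by (rule complex_vector.span_mono)
  moreover have "cspan {u i j | (u :: nat \<Rightarrow> nat \<Rightarrow> 'a) I i j. corep_matrix I u \<and> i \<in> I \<and> j \<in> I} \<subseteq> \<A>"
    by (rule complex_vector.span_minimal[OF _ subspace]) (auto simp: corep_matrix_def comult_matrix_def)
  ultimately show ?thesis by blast
qed

text \<open>Zero is a multiple of \<open>1\<close>, a coefficient of the trivial corepresentation, and so needs no case.\<close>

lemma coefficient_induct [consumes 1, case_names add scale coefficient]:
  assumes a: "a \<in> \<A>"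
    and add: "\<And>a b. a \<in> \<A> \<Longrightarrow> b \<in> \<A> \<Longrightarrow> P a \<Longrightarrow> P b \<Longrightarrow> P (a + b)"
    and scale: "\<And>c a. a \<in> \<A> \<Longrightarrow> P a \<Longrightarrow> P (c *\<^sub>C a)"
    and coeff: "\<And>I (u :: nat \<Rightarrow> nat \<Rightarrow> 'a) i j. corep_matrix I u \<Longrightarrow> i \<in> I \<Longrightarrow> j \<in> I \<Longrightarrow> P (u i j)"
  shows "P a"
proof -
  let ?C = "{u i j | (u :: nat \<Rightarrow> nat \<Rightarrow> 'a) I i j. corep_matrix I u \<and> i \<in> I \<and> j \<in> I}"
  have "P 0" 
    using scale[OF one_closed, of 0] coeff[OF corep_matrix_one[of "0::nat"], of 0 0] by simp
  have "cspan ?C \<subseteq> {x \<in> \<A>. P x}"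
  proof (rule complex_vector.span_minimal)
    show "?C \<subseteq> {x \<in> \<A>. P x}"
      using coeff by (auto dest: corep_matrixD)
    show "csubspace {x \<in> \<A>. P x}"
      using \<open>P 0\<close> add scale subspace by (auto simp: complex_vector.subspace_def)
  qed
  then show ?thesis using a coefficients_span by blast
qed

lemma linear_ext_coefficients:
  assumes "linear_on_subspace \<A> F" "linear_on_subspace \<A> G"
    and "\<And>I (u :: nat \<Rightarrow> nat \<Rightarrow> 'a) i j. corep_matrix I u \<Longrightarrow> i \<in> I \<Longrightarrow> j \<in> I \<Longrightarrow> F (u i j) = G (u i j)"
    and "a \<in> \<A>"
  shows "F a = G a"
  using assms(4)
  by (induction rule: coefficient_induct)
    (simp_all add: assms(3) linear_on_subspace_add[OF assms(1)] linear_on_subspace_add[OF assms(2)]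
      linear_on_subspace_scaleC[OF assms(1)] linear_on_subspace_scaleC[OF assms(2)])

lemma linear_comp:
  assumes "linear_on_subspace \<A> F" "linear_on_subspace \<A> G" "\<And>a. a \<in> \<A> \<Longrightarrow> G a \<in> \<A>"
  shows "linear_on_subspace \<A> (\<lambda>a. F (G a))"
  using assms by (simp add: linear_on_subspace_def)

lemma conv_left_matrix:
  assumes "comult_matrix I u" "linear_on_subspace \<A> l" "i \<in> I" "j \<in> I"
  shows "conv_left tens \<Delta> l (u i j) = (\<Sum>k\<in>I. l (u k j) *\<^sub>C u i k)"
  unfolding conv_left_def coefficients[symmetric] comult_matrixD(3)[OF assms(1,3,4)]
  using comult_matrixD[OF assms(1)] assms(3,4)
  by (intro lift_eq[OF bilinear_on_functional_right[OF assms(2)]]) auto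

lemma conv_right_matrix:
  assumes "comult_matrix I u" "linear_on_subspace \<A> l" "i \<in> I" "j \<in> I"
  shows "conv_right tens \<Delta> (u i j) l = (\<Sum>k\<in>I. l (u i k) *\<^sub>C u k j)"
  unfolding conv_right_def coefficients[symmetric] comult_matrixD(3)[OF assms(1,3,4)]
  using comult_matrixD[OF assms(1)] assms(3,4)
  by (intro lift_eq[OF bilinear_on_functional_left[OF assms(2)]]) auto

text \<open>The matrices \<open>f z (u i j)\<close> form a one-parameter group. This is how the convolution identity
  for the characters is used, and it replaces coassociativity in all later computations.\<close>

lemma woronowicz_matrix_mult:
  assumes "comult_matrix I u" "i \<in> I" "j \<in> I"
  shows "(\<Sum>k\<in>I. f z (u i k) * f w (u k j)) = f (z + w) (u i j)"
proof -
  have "conv tens \<Delta> (f z) (f w) (u i j) = (\<Sum>k\<in>I. f z (u i k) * f w (u k j))"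
    unfolding conv_def coefficients[symmetric] comult_matrixD(3)[OF assms]
    using comult_matrixD[OF assms(1)] assms(2,3)
    by (intro lift_eq[OF bilinear_on_functionals[OF woronowicz_linear woronowicz_linear]]) auto
  then show ?thesis using woronowicz_conv comult_matrixD[OF assms] by simp
qed

text \<open>The counit axiom reads \<open>u \<cdot> \<epsilon>(u) = u\<close>, and \<open>u\<close> can be cancelled by its adjoint.\<close>

lemma counit_corep:
  assumes u: "corep_matrix I u" and "i \<in> I" "j \<in> I"
  shows "\<epsilon> (u i j) = (if i = j then 1 else 0)"
proof -
  have "\<epsilon> (u i j) *\<^sub>C 1 = (\<Sum>k\<in>I. \<epsilon> (u k j) *\<^sub>C (if i = k then 1 else (0::'a)))"
    using assms corep_matrixD(1)[OF assms] by (simp add: if_distrib cong: if_cong)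
  also have "\<dots> = (\<Sum>k\<in>I. \<epsilon> (u k j) *\<^sub>C (\<Sum>m\<in>I. star (u m i) * u m k))"
    using assms by (simp add: corep_matrixD(2-))
  also have "\<dots> = (\<Sum>k\<in>I. \<Sum>m\<in>I. star (u m i) * (\<epsilon> (u k j) *\<^sub>C u m k))"
    by (simp add: complex_vector.scale_sum_right scaleC_mult_right)
  also have "\<dots> = (\<Sum>m\<in>I. \<Sum>k\<in>I. star (u m i) * (\<epsilon> (u k j) *\<^sub>C u m k))"
    by (rule sum.swap)
  also have "\<dots> = (\<Sum>m\<in>I. star (u m i) * conv_left tens \<Delta> \<epsilon> (u m j))"
    using assms by (simp add: sum_distrib_left conv_left_matrix[OF corep_comult[OF u]] counit_linear)
  also have "\<dots> = (\<Sum>m\<in>I. star (u m i) * u m j)"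
    using assms by (intro sum.cong) (simp_all add: counit_right corep_matrixD(2))
  also have "\<dots> = (if i = j then 1 else 0)"
    using assms by (rule corep_matrixD)
  finally have "\<epsilon> (u i j) *\<^sub>C (1::'a) = (if i = j then 1 else 0) *\<^sub>C 1" by (simp add: scaleC_one)
  then show ?thesis unfolding complex_vector.scale_cancel_right by simp
qed

text \<open>By the antipode axiom the matrix \<open>S(u)\<close> is a left inverse of \<open>u\<close>, and the adjoint matrix of \<open>u\<close>
  is a right inverse, so the two agree.\<close>

lemma antipode_corep:
  assumes u: "corep_matrix I u" and "i \<in> I" "j \<in> I"
  shows "S (u i j) = star (u j i)"
proof -
  have inv: "(\<Sum>k\<in>I. S (u i k) * u k m) = (if i = m then 1 else 0)" if "m \<in> I" for m
  proof -
    have "tensor_lift tens \<A> (\<lambda>x y. S x * y) (\<Delta> (u i m)) = (\<Sum>k\<in>I. S (u i k) * u k m)"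
      unfolding corep_matrixD(3)[OF u \<open>i \<in> I\<close> that]
      using corep_matrixD[OF u] \<open>i \<in> I\<close> that
      by (intro lift_eq[OF bilinear_on_antipode_mult]) auto
    then show ?thesis
      using antipode_left[OF corep_matrixD(2)[OF u \<open>i \<in> I\<close> that]] counit_corep[OF u \<open>i \<in> I\<close> that]
      by (simp add: scaleC_one split: if_splits)
  qed
  have "S (u i j) = (\<Sum>k\<in>I. S (u i k) * (if k = j then 1 else 0))"
    using assms corep_matrixD(1)[OF assms] by (simp add: if_distrib cong: if_cong)
  also have "\<dots> = (\<Sum>k\<in>I. S (u i k) * (\<Sum>m\<in>I. u k m * star (u j m)))"
    using assms by (simp add: corep_matrixD(2-))
  also have "\<dots> = (\<Sum>k\<in>I. \<Sum>m\<in>I. (S (u i k) * u k m) * star (u j m))"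
    by (simp add: sum_distrib_left mult.assoc)
  also have "\<dots> = (\<Sum>m\<in>I. \<Sum>k\<in>I. (S (u i k) * u k m) * star (u j m))"
    by (rule sum.swap)
  also have "\<dots> = (\<Sum>m\<in>I. (if i = m then 1 else 0) * star (u j m))"
    by (simp add: sum_distrib_right[symmetric] inv)
  also have "\<dots> = star (u j i)"
    using assms corep_matrixD(1)[OF assms] by (simp add: if_distrib[of "\<lambda>x. x * _"] cong: if_cong)
  finally show ?thesis .
qed

section \<open>The one-parameter group behind the unitary antipode\<close>

text \<open>The maps \<open>a \<mapsto> f\<^sub>z \<star> a \<star> f\<^sub>-\<^sub>z\<close>; for imaginary \<open>z\<close> they are, up to the scaling of the
  parameter, the scaling automorphisms of the quantum group.\<close>

definition twist :: "complex \<Rightarrow> 'a \<Rightarrow> 'a" where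
  "twist z a = conv_right tens \<Delta> (conv_left tens \<Delta> (f z) a) (f (- z))"

lemma twist_linear: "linear_on_subspace \<A> (twist z)"
  unfolding twist_def[abs_def]
  by (rule linear_comp[OF conv_right_linear[OF woronowicz_linear]
        conv_left_linear[OF woronowicz_linear] conv_left_closed[OF woronowicz_linear]])

lemma twist_closed: "a \<in> \<A> \<Longrightarrow> twist z a \<in> \<A>"
  by (simp add: twist_def conv_left_closed conv_right_closed woronowicz_linear)

lemma twist_matrix:
  assumes u: "comult_matrix I u" and "i \<in> I" "j \<in> I"
  shows "twist z (u i j) = (\<Sum>k\<in>I. \<Sum>l\<in>I. (f (- z) (u i k) * f z (u l j)) *\<^sub>C u k l)"
proof -
  have "twist z (u i j) = conv_right tens \<Delta> (\<Sum>l\<in>I. f z (u l j) *\<^sub>C u i l) (f (- z))"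
    using assms by (simp add: twist_def conv_left_matrix woronowicz_linear)
  also have "\<dots> = (\<Sum>l\<in>I. f z (u l j) *\<^sub>C conv_right tens \<Delta> (u i l) (f (- z)))"
    using assms
    by (intro linear_on_subspace_combination[OF conv_right_linear[OF woronowicz_linear] subspace])
      (simp add: comult_matrixD)
  also have "\<dots> = (\<Sum>l\<in>I. \<Sum>k\<in>I. (f (- z) (u i k) * f z (u l j)) *\<^sub>C u k l)"
    using assms
    by (simp add: conv_right_matrix woronowicz_linear complex_vector.scale_sum_right mult.commute)
  also have "\<dots> = (\<Sum>k\<in>I. \<Sum>l\<in>I. (f (- z) (u i k) * f z (u l j)) *\<^sub>C u k l)"
    by (rule sum.swap)
  finally show ?thesis .
qed

lemma linear_twist_matrix:
  assumes "linear_on_subspace \<A> F" "comult_matrix I u" "i \<in> I" "j \<in> I"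
  shows "F (twist z (u i j)) = (\<Sum>k\<in>I. \<Sum>l\<in>I. (f (- z) (u i k) * f z (u l j)) *\<^sub>C F (u k l))"
proof -
  have u: "u k l \<in> \<A>" if "k \<in> I" "l \<in> I" for k l using comult_matrixD[OF assms(2)] that by blast
  have "F (twist z (u i j)) = (\<Sum>k\<in>I. F (\<Sum>l\<in>I. (f (- z) (u i k) * f z (u l j)) *\<^sub>C u k l))"
    unfolding twist_matrix[OF assms(2-)] using u
    by (intro linear_on_subspace_sum[OF assms(1) subspace]) (auto intro!: closed)
  also have "\<dots> = (\<Sum>k\<in>I. \<Sum>l\<in>I. (f (- z) (u i k) * f z (u l j)) *\<^sub>C F (u k l))"
    using u by (intro sum.cong[OF refl] linear_on_subspace_combination[OF assms(1) subspace]) auto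
  finally show ?thesis .
qed

lemma twist_zero:
  assumes "a \<in> \<A>" shows "twist 0 a = a"
proof -
  have "conv_left tens \<Delta> (f 0) a = conv_left tens \<Delta> \<epsilon> a" if "a \<in> \<A>" for a
    using that
  proof (rule linear_ext_coefficients[rotated -1])
    show "conv_left tens \<Delta> (f 0) (u i j) = conv_left tens \<Delta> \<epsilon> (u i j)"
      if "corep_matrix I u" "i \<in> I" "j \<in> I" for I i j and u :: "nat \<Rightarrow> nat \<Rightarrow> 'a"
      using that by (simp add: conv_left_matrix[OF corep_comult[OF that(1)]] woronowicz_linear
          counit_linear woronowicz_zero corep_matrixD(2))
  qed (simp_all add: conv_left_linear woronowicz_linear counit_linear)
  moreover have "conv_right tens \<Delta> a (f 0) = conv_right tens \<Delta> a \<epsilon>" if "a \<in> \<A>" for a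
    using that
  proof (rule linear_ext_coefficients[rotated -1])
    show "conv_right tens \<Delta> (u i j) (f 0) = conv_right tens \<Delta> (u i j) \<epsilon>"
      if "corep_matrix I u" "i \<in> I" "j \<in> I" for I i j and u :: "nat \<Rightarrow> nat \<Rightarrow> 'a"
      using that by (simp add: conv_right_matrix[OF corep_comult[OF that(1)]] woronowicz_linear
          counit_linear woronowicz_zero corep_matrixD(2))
  qed (simp_all add: conv_right_linear woronowicz_linear counit_linear)
  ultimately show ?thesis
    using assms by (simp add: twist_def counit_left counit_right)
qed

text \<open>On a matrix of coefficients \<open>twist z\<close> is conjugation \<open>u \<mapsto> f\<^sub>-\<^sub>z(u) \<cdot> u \<cdot> f\<^sub>z(u)\<close>, and the outer
  factors multiply by \<open>woronowicz_matrix_mult\<close>.\<close>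

lemma twist_twist:
  assumes "a \<in> \<A>" shows "twist z (twist w a) = twist (z + w) a"
  using linear_comp[OF twist_linear twist_linear twist_closed] twist_linear _ assms
proof (rule linear_ext_coefficients)
  fix I i j and u :: "nat \<Rightarrow> nat \<Rightarrow> 'a"
  assume "corep_matrix I u" and ij: "i \<in> I" "j \<in> I"
  then have u: "comult_matrix I u" by (simp add: corep_comult)
  have "twist z (twist w (u i j)) =
      (\<Sum>k\<in>I. \<Sum>l\<in>I. \<Sum>p\<in>I. \<Sum>q\<in>I.
        (f (- w) (u i k) * f w (u l j) * (f (- z) (u k p) * f z (u q l))) *\<^sub>C u p q)"
    unfolding linear_twist_matrix[OF twist_linear u ij]
    using ij by (simp add: twist_matrix[OF u] complex_vector.scale_sum_right scaleC_scaleC)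
  also have "\<dots> = (\<Sum>(k, l)\<in>I \<times> I. \<Sum>(p, q)\<in>I \<times> I.
        (f (- w) (u i k) * f w (u l j) * (f (- z) (u k p) * f z (u q l))) *\<^sub>C u p q)"
    by (simp add: sum.cartesian_product[symmetric])
  also have "\<dots> = (\<Sum>(p, q)\<in>I \<times> I. \<Sum>(k, l)\<in>I \<times> I.
        (f (- w) (u i k) * f w (u l j) * (f (- z) (u k p) * f z (u q l))) *\<^sub>C u p q)"
    by (simp only: split_def, rule sum.swap)
  also have "\<dots> = (\<Sum>p\<in>I. \<Sum>q\<in>I. \<Sum>k\<in>I. \<Sum>l\<in>I.
        (f (- w) (u i k) * f w (u l j) * (f (- z) (u k p) * f z (u q l))) *\<^sub>C u p q)"
    by (simp add: sum.cartesian_product[symmetric])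
  also have "\<dots> = (\<Sum>p\<in>I. \<Sum>q\<in>I. ((\<Sum>k\<in>I. f (- w) (u i k) * f (- z) (u k p)) *
      (\<Sum>l\<in>I. f z (u q l) * f w (u l j))) *\<^sub>C u p q)"
    unfolding sum_product by (simp add: complex_vector.scale_sum_left mult_ac)
  also have "\<dots> = twist (z + w) (u i j)"
    using u ij minus_diff_commute[of w z]
    by (simp add: woronowicz_matrix_mult twist_matrix add.commute)
  finally show "twist z (twist w (u i j)) = twist (z + w) (u i j)" .
qed

text \<open>On a matrix of coefficients the counit turns the middle factor of \<open>f\<^sub>-\<^sub>z(u) \<cdot> u \<cdot> f\<^sub>z(u)\<close> into the
  identity, and the outer factors are inverse to each other.\<close>

lemma counit_twist:
  assumes "a \<in> \<A>" shows "\<epsilon> (twist z a) = \<epsilon> a"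
  using linear_comp[OF counit_linear twist_linear twist_closed] counit_linear _ assms
proof (rule linear_ext_coefficients)
  fix I i j and u :: "nat \<Rightarrow> nat \<Rightarrow> 'a"
  assume u: "corep_matrix I u" and ij: "i \<in> I" "j \<in> I"
  note c = corep_comult[OF u]
  have "\<epsilon> (twist z (u i j)) =
      (\<Sum>k\<in>I. \<Sum>l\<in>I. (f (- z) (u i k) * f z (u l j)) * (if k = l then 1 else 0))"
    using u ij by (simp add: linear_twist_matrix[OF counit_linear c] counit_corep scaleC_complex_def)
  also have "\<dots> = (\<Sum>k\<in>I. f (- z) (u i k) * f z (u k j))"
    using corep_matrixD(1)[OF u ij] by (simp add: if_distrib cong: if_cong)
  also have "\<dots> = \<epsilon> (u i j)"
    using u ij c by (simp add: woronowicz_matrix_mult woronowicz_zero corep_matrixD)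
  finally show "\<epsilon> (twist z (u i j)) = \<epsilon> (u i j)" .
qed

text \<open>The involution turns the coefficients \<open>f\<^sub>z(u)\<close> into those of \<open>f\<^sub>w\<close> at the entrywise adjoint
  of \<open>u\<close>, with \<open>w = - cnj z\<close>.\<close>

lemma star_twist:
  assumes "a \<in> \<A>" shows "star (twist z a) = twist (- cnj z) (star a)"
  using assms
proof (induction rule: coefficient_induct)
  case (add a b)
  then show ?case
    by (simp add: linear_on_subspace_add[OF twist_linear] star_add closed)
next
  case (scale c a)
  then show ?case
    by (simp add: linear_on_subspace_scaleC[OF twist_linear] star_scaleC closed)
next
  case (coefficient I u i j)
  then have u: "comult_matrix I u" by (simp add: corep_comult)
  show ?case
    unfolding twist_matrix[OF u coefficient(2,3)]
      twist_matrix[OF comult_matrix_star[OF u] coefficient(2,3)]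
    using coefficient woronowicz_star[of _ z] woronowicz_star[of _ "- z"]
    by (simp add: cstar_star_sum star_scaleC corep_matrixD(2))
qed

lemma antipode_star_antipode:
  assumes "a \<in> \<A>" shows "S (star (S a)) = star a"
  using assms
proof (induction rule: coefficient_induct)
  case (add a b)
  then show ?case
    by (simp add: linear_on_subspace_add[OF antipode_linear] star_add closed)
next
  case (scale c a)
  then show ?case
    by (simp add: linear_on_subspace_scaleC[OF antipode_linear] star_scaleC closed)
next
  case (coefficient I u i j)
  then show ?case by (simp add: antipode_corep star_star)
qed

text \<open>The square of the antipode is \<open>twist (- 1)\<close>, which has the inverse \<open>twist 1\<close>.\<close>

lemma antipode_injective:
  assumes "a \<in> \<A>" "b \<in> \<A>" "S a = S b"
  shows "a = b"
proof -
  have "S (S c) = twist (- 1) c" if "c \<in> \<A>" for c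
    using antipode_squared[OF that] by (simp add: twist_def)
  then have "twist (- 1) a = twist (- 1) b" using assms by metis
  then have "twist 1 (twist (- 1) a) = twist 1 (twist (- 1) b)" by simp
  then show ?thesis using assms by (simp add: twist_twist twist_zero)
qed

section \<open>Properties of the unitary antipode\<close>

abbreviation R :: "'a \<Rightarrow> 'a" where "R \<equiv> unitary_antipode tens \<Delta> S f"

lemma unitary_antipode_eq_twist: "R a = S (twist (1/2) a)"
  by (simp add: unitary_antipode_def twist_def)

lemma unitary_antipode_linear: "linear_on_subspace \<A> R"
  using linear_comp[OF antipode_linear twist_linear twist_closed, of "1/2"]
  by (simp add: unitary_antipode_eq_twist[abs_def])

lemma unitary_antipode_closed: "a \<in> \<A> \<Longrightarrow> R a \<in> \<A>"
  by (simp add: unitary_antipode_eq_twist antipode_closed twist_closed)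

text \<open>After an application of the injective map \<open>S\<close>, both sides become \<open>twist (- 1/2) (star a)\<close>.\<close>

lemma unitary_antipode_star:
  assumes "a \<in> \<A>" shows "R (star a) = star (R a)"
proof -
  let ?b = "twist (1/2) a" and ?c = "twist (1/2) (star a)"
  have "S (star (S ?b)) = star ?b"
    using assms by (simp add: antipode_star_antipode twist_closed)
  also have "\<dots> = twist (- (1/2)) (star a)"
    using assms by (simp add: star_twist)
  also have "\<dots> = twist (- 1) ?c"
    using assms by (simp add: twist_twist closed)
  also have "\<dots> = S (S ?c)"
    using assms antipode_squared[of ?c] by (simp add: twist_def[of "- 1"] closed twist_closed)
  finally have eq: "S (star (S ?b)) = S (S ?c)" .
  have "star (S ?b) = S ?c"
    by (rule antipode_injective[OF _ _ eq]) (use assms in \<open>simp_all add: closed twist_closed\<close>)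
  then show ?thesis by (simp add: unitary_antipode_eq_twist)
qed

lemma counit_unitary_antipode:
  assumes "a \<in> \<A>" shows "\<epsilon> (R a) = \<epsilon> a"
proof -
  have "\<epsilon> (S b) = \<epsilon> b" if "b \<in> \<A>" for b
    using that woronowicz_antipode[of b 0] by (simp add: woronowicz_zero closed)
  then show ?thesis using assms by (simp add: unitary_antipode_eq_twist counit_twist twist_closed)
qed

lemma counit_star: "a \<in> \<A> \<Longrightarrow> \<epsilon> (star a) = cnj (\<epsilon> a)"
  using woronowicz_star[of a 0] by (simp add: woronowicz_zero closed)

lemma unitary_antipode_corep:
  assumes "corep_matrix I u" "i \<in> I" "j \<in> I"
  shows "R (u i j) = (\<Sum>k\<in>I. \<Sum>l\<in>I. (f (- (1/2)) (u i k) * f (1/2) (u l j)) *\<^sub>C star (u l k))"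
  unfolding unitary_antipode_eq_twist
    linear_twist_matrix[OF antipode_linear corep_comult[OF assms(1)] assms(2,3)]
  using assms by (simp add: antipode_corep)

lemma unitary_antipode_one: "R 1 = 1"
  using unitary_antipode_corep[OF corep_matrix_one, of 0 0]
  by (simp add: woronowicz_one scaleC_one)

text \<open>The products \<open>u i j * v p q\<close> are the entries of a unitary corepresentation on \<open>I \<times> J\<close>. In the
  explicit formula for \<open>R\<close> on its entries the characters factorize by multiplicativity, and the
  involution reverses the order of \<open>u\<close> and \<open>v\<close>.\<close>

lemma unitary_antipode_mult_coefficients:
  assumes u: "corep_matrix I u" "i \<in> I" "j \<in> I" and v: "corep_matrix J v" "p \<in> J" "q \<in> J"
  shows "R (u i j * v p q) = R (v p q) * R (u i j)"
proof -
  let ?g = "\<lambda>k l. f (- (1/2)) (u i k) * f (1/2) (u l j)"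
  let ?h = "\<lambda>m n. f (- (1/2)) (v p m) * f (1/2) (v n q)"
  have "R (u i j * v p q) = R ((\<lambda>(i, p) (j, q). u i j * v p q) (i, p) (j, q))" by simp
  also have "\<dots> = (\<Sum>(k, m)\<in>I \<times> J. \<Sum>(l, n)\<in>I \<times> J.
      (f (- (1/2)) (u i k * v p m) * f (1/2) (u l j * v n q)) *\<^sub>C star (u l k * v n m))"
    using u v by (subst unitary_antipode_corep[OF corep_matrix_product[OF u(1) v(1)]])
      (auto simp: split_def)
  also have "\<dots> = (\<Sum>k\<in>I. \<Sum>m\<in>J. \<Sum>l\<in>I. \<Sum>n\<in>J.
      (f (- (1/2)) (u i k * v p m) * f (1/2) (u l j * v n q)) *\<^sub>C star (u l k * v n m))"
    by (simp add: sum.cartesian_product[symmetric])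
  also have "\<dots> = (\<Sum>k\<in>I. \<Sum>m\<in>J. \<Sum>l\<in>I. \<Sum>n\<in>J.
      (?h m n *\<^sub>C star (v n m)) * (?g k l *\<^sub>C star (u l k)))"
    using u v by (intro sum.cong[OF refl]) (simp add: woronowicz_mult corep_matrixD(2) star_mult
        scaleC_mult_left scaleC_mult_right scaleC_scaleC mult_ac)
  also have "\<dots> = (\<Sum>m\<in>J. \<Sum>k\<in>I. \<Sum>n\<in>J. \<Sum>l\<in>I.
      (?h m n *\<^sub>C star (v n m)) * (?g k l *\<^sub>C star (u l k)))"
    by (subst sum.swap) (intro sum.cong[OF refl] sum.swap)
  also have "\<dots> = R (v p q) * R (u i j)"
    unfolding unitary_antipode_corep[OF u] unitary_antipode_corep[OF v]
    by (subst sum_product)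
      (simp add: sum_product)
  finally show ?thesis .
qed

lemma unitary_antipode_mult:
  assumes "a \<in> \<A>" "b \<in> \<A>"
  shows "R (a * b) = R b * R a"
  using assms(1)
proof (induction rule: coefficient_induct)
  case (add a a')
  then show ?case using assms(2)
    by (simp add: linear_on_subspace_add[OF unitary_antipode_linear] closed distrib_left distrib_right)
next
  case (scale c a)
  then show ?case using assms(2)
    by (simp add: linear_on_subspace_scaleC[OF unitary_antipode_linear] closed
        scaleC_mult_left scaleC_mult_right)
next
  case (coefficient I u i j)
  note u = coefficient and ua = corep_matrixD(2)[OF coefficient]
  from assms(2) show ?case
  proof (induction rule: coefficient_induct)
    case (add b b')
    then show ?case using ua
      by (simp add: linear_on_subspace_add[OF unitary_antipode_linear] closed distrib_left distrib_right)
  next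
    case (scale c b)
    then show ?case using ua
      by (simp add: linear_on_subspace_scaleC[OF unitary_antipode_linear] closed
          scaleC_mult_left scaleC_mult_right)
  next
    case (coefficient J v p q)
    then show ?case by (intro unitary_antipode_mult_coefficients[OF u])
  qed
qed

end

section \<open>The opposite Schuermann triple\<close>

text \<open>The roles of an operator and its adjoint are exchanged, because the opposite inner product
  exchanges its arguments.\<close>

lemma is_adjoint_opposite:
  "is_adjoint T T' \<Longrightarrow> is_adjoint (\<lambda>v. Opp (T' (unopp v))) (\<lambda>v. Opp (T (unopp v)))"
  by (simp add: is_adjoint_def cinner_opposite_def)

lemma clinear_opposite:
  "clinear T \<Longrightarrow> clinear (\<lambda>v. Opp (T (unopp v)))"
  by (simp add: Vector_Spaces.linear_iff plus_opposite_def scaleC_opposite_def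
      complex_vector.vector_space_axioms)

theorem theorem5p4:
  fixes tens :: "'a::cstar_algebra \<Rightarrow> 'a \<Rightarrow> 'b::cstar_algebra"
    and tens_l :: "'b \<Rightarrow> 'a \<Rightarrow> 'c::cstar_algebra"
    and tens_r :: "'a \<Rightarrow> 'b \<Rightarrow> 'c"
    and \<Delta> :: "'a \<Rightarrow> 'b"
    and \<A> :: "'a set"
    and \<epsilon> h \<phi> :: "'a \<Rightarrow> complex"
    and S R :: "'a \<Rightarrow> 'a"
    and f :: "complex \<Rightarrow> 'a \<Rightarrow> complex"
    and \<pi> :: "'a \<Rightarrow> 'd::pre_hilbert \<Rightarrow> 'd"
    and \<eta> :: "'a \<Rightarrow> 'd"
  assumes "cqg_hopf_star_algebra tens tens_l tens_r \<Delta> \<A> \<epsilon> S h f"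
    and "R = unitary_antipode tens \<Delta> S f"
    and "generating_functional \<A> \<epsilon> \<phi>"
    and "schuermann_triple \<A> \<epsilon> \<pi> \<eta> \<phi>"
  shows "generating_functional \<A> \<epsilon> (\<phi> \<circ> R)
    \<and> schuermann_triple \<A> \<epsilon> (opposite_rep R \<pi>) (opposite_cocycle R \<eta>) (\<phi> \<circ> R)"
proof -
  interpret H: cqg_hopf_star_algebra tens tens_l tens_r \<Delta> \<A> \<epsilon> S h f by (fact assms(1))
  note RA = H.unitary_antipode_closed[folded assms(2)]
    and R_star = H.unitary_antipode_star[folded assms(2)]
    and R_mult = H.unitary_antipode_mult[folded assms(2)]
    and R_one = H.unitary_antipode_one[folded assms(2)]
    and counit_R = H.counit_unitary_antipode[folded assms(2)]
    and R_linear = H.unitary_antipode_linear[folded assms(2)]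
  note R_add = linear_on_subspace_add[OF R_linear] and R_scaleC = linear_on_subspace_scaleC[OF R_linear]
  note closed = H.closed RA
  have rep: "unital_star_rep \<A> \<pi>" and \<eta>_linear: "linear_on_subspace \<A> \<eta>"
    and cocycle: "\<And>a b. a \<in> \<A> \<Longrightarrow> b \<in> \<A> \<Longrightarrow> \<eta> (a * b) = \<pi> a (\<eta> b) + \<epsilon> b *\<^sub>C \<eta> a"
    and \<phi>_linear: "linear_on_subspace \<A> \<phi>" and \<phi>_herm: "hermitian_on \<A> \<phi>"
    and \<phi>_mult: "\<And>a b. a \<in> \<A> \<Longrightarrow> b \<in> \<A> \<Longrightarrow> \<epsilon> a = 0 \<Longrightarrow> \<epsilon> b = 0 \<Longrightarrow>
      \<phi> (a * b) = cinner (\<eta> (star a)) (\<eta> b)"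
    using assms(4) by (simp_all add: schuermann_triple_def)
  have lin: "linear_on_subspace \<A> (\<phi> \<circ> R)"
    using H.linear_comp[OF \<phi>_linear R_linear RA] by (simp add: comp_def)
  have herm: "hermitian_on \<A> (\<phi> \<circ> R)"
    using \<phi>_herm by (simp add: hermitian_on_def R_star RA)
  have "(\<phi> \<circ> R) (star a * a) \<in> \<real>\<^sub>\<ge>\<^sub>0" if "a \<in> \<A>" "\<epsilon> a = 0" for a
  proof -
    have "R (star a * a) = star (R (star a)) * R (star a)"
      using that by (simp add: R_mult R_star star_star closed)
    moreover have "\<epsilon> (R (star a)) = 0"
      using that by (simp add: counit_R H.counit_star closed)
    ultimately show ?thesis
      using assms(3) that by (simp add: generating_functional_def closed)
  qed
  moreover have "\<phi> 1 = 0" using assms(3) by (simp add: generating_functional_def)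
  ultimately have "generating_functional \<A> \<epsilon> (\<phi> \<circ> R)"
    using lin herm by (simp add: generating_functional_def R_one)
  moreover have "unital_star_rep \<A> (opposite_rep R \<pi>)"
  proof -
    have ops: "clinear (\<pi> a)" if "a \<in> \<A>" for a
      using rep that by (auto simp: unital_star_rep_def adjointable_ops_def)
    have adj: "is_adjoint (\<pi> (star a)) (\<pi> a)" if "a \<in> \<A>" for a
      using rep that by (auto simp: unital_star_rep_def)
    have opp_linear: "clinear (opposite_rep R \<pi> a)" if "a \<in> \<A>" for a
      unfolding opposite_rep_def[abs_def] using that by (intro clinear_opposite ops) (simp add: closed)
    have opp_adj: "is_adjoint (opposite_rep R \<pi> (star a)) (opposite_rep R \<pi> a)" if "a \<in> \<A>" for a
      unfolding opposite_rep_def[abs_def] star_star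
      using adj[OF RA[OF that]] that by (intro is_adjoint_opposite) (simp add: R_star)
    have "opposite_rep R \<pi> a \<in> \<L>\<^sup>#" if "a \<in> \<A>" for a
      using opp_linear[OF that] opp_linear[OF H.star_closed[OF that]] opp_adj[OF that]
      by (auto simp: adjointable_ops_def)
    moreover have "linear_on_subspace \<A> (\<lambda>a. opposite_rep R \<pi> a v)" for v
      using rep
      by (simp add: unital_star_rep_def linear_on_subspace_def opposite_rep_def plus_opposite_def
          scaleC_opposite_def star_add star_scaleC R_add R_scaleC closed)
    moreover have "opposite_rep R \<pi> 1 = id"
      using rep by (simp add: unital_star_rep_def opposite_rep_def fun_eq_iff R_one)
    moreover have "opposite_rep R \<pi> (a * b) = opposite_rep R \<pi> a \<circ> opposite_rep R \<pi> b"
      if "a \<in> \<A>" "b \<in> \<A>" for a b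
      using rep that
      by (simp add: unital_star_rep_def opposite_rep_def fun_eq_iff star_mult R_mult closed)
    ultimately show ?thesis using opp_adj by (simp add: unital_star_rep_def)
  qed
  moreover have "linear_on_subspace \<A> (opposite_cocycle R \<eta>)"
    using \<eta>_linear
    by (simp add: linear_on_subspace_def opposite_cocycle_def plus_opposite_def
        scaleC_opposite_def star_add star_scaleC R_add R_scaleC closed)
  moreover have "opposite_cocycle R \<eta> (a * b) =
      opposite_rep R \<pi> a (opposite_cocycle R \<eta> b) + \<epsilon> b *\<^sub>C opposite_cocycle R \<eta> a"
    if "a \<in> \<A>" "b \<in> \<A>" for a b
    using that
    by (simp add: opposite_cocycle_def opposite_rep_def plus_opposite_def scaleC_opposite_def
        star_mult R_mult cocycle counit_R H.counit_star closed)
  moreover have "(\<phi> \<circ> R) (a * b) =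
      cinner (opposite_cocycle R \<eta> (star a)) (opposite_cocycle R \<eta> b)"
    if "a \<in> \<A>" "b \<in> \<A>" "\<epsilon> a = 0" "\<epsilon> b = 0" for a b
    using that
    by (simp add: opposite_cocycle_def cinner_opposite_def R_mult \<phi>_mult counit_R R_star star_star
        closed)
  ultimately show ?thesis using lin herm by (simp add: schuermann_triple_def)
qed

end
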